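(* Consider the energy-harvesting power control problem described in the context. Assume there exist a constant $\theta^\ast\in\mathbb{R}$ and a function $V^\ast(Q,E)$ on $[0,\infty)\times[0,N_E]$ that solve the equivalent optimality equation $$\theta^\ast+V^\ast(Q,E)=\mathbb{E}\Big[\min_{0\le p\le E/\tau}\Big\{\frac{Q}{\overline{\lambda}}+\mathbb{E}\big[V^\ast(Q',E')\,\big|\,\boldsymbol{\chi}=(h,Q,E),\,p\big]\Big\}\,\Big|\,Q,E\Big]\qquad\forall\,Q,E,$$ where the outer expectation is over $h\sim\mathcal{CN}(0,1)$ and the inner one is over the next queue state $(Q',E')$ given the current state $\boldsymbol{\chi}$ and action $p$. Assume furthermore that for every admissible control policy $\Omega$ and every initial queue state $(Q(0),E(0))$ the transversality condition $$\lim_{N\to\infty}\frac1N\,\mathbb{E}^{\Omega}\big[V^\ast(Q(N),E(N))\,\big|\,Q(0),E(0)\big]=0$$ holds. Then: (1) $\theta^\ast=\min_{\Omega}\overline{D}(\Omega)$ is the optimal average cost for any initial state $\boldsymbol{\chi}(0)$. (2) Suppose there exists an admissible stationary control policy $\Omega^\ast$ with $\Omega^\ast(\boldsymbol{\chi})=p^\ast$ for every $\boldsymbol{\chi}=(h,Q,E)$, where $p^\ast$ attains the minimum over $p$ on the right-hand side of the optimality equation for the given $\boldsymbol{\chi}$. Then $\Omega^\ast$ is an optimal control policy, i.e. it minimizes $\overline{D}(\Omega)$.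
   Context: Discrete-time system with slot duration $\tau>0$ and slots $n=0,1,2,\dots$. The state is $\boldsymbol{\chi}(n)=(h(n),Q(n),E(n))$: the channel $h(n)\in\mathbb{C}$ is i.i.d. over slots with $h(n)\sim\mathcal{CN}(0,1)$; $Q(n)\in[0,\infty)$ is the data queue; $E(n)\in[0,N_E]$ is the energy queue with finite capacity $N_E$. With transmit power $p\ge 0$ the rate is $R(h,p)=\log(1+p|h|^2)$. The queues evolve as $$Q(n+1)=[Q(n)-R(h(n),p(n))\tau]^+ +\lambda(n)\tau,\qquad E(n+1)=\min\{E(n)-p(n)\tau+\alpha(n)\tau,\;N_E\},$$ where $\lambda(n)\ge0$ is the random data arrival rate (i.i.d. over slots, finite mean $\overline{\lambda}$), $\alpha(n)\ge0$ is the random energy arrival rate (finite mean $\overline{\alpha}$), and $[x]^+=\max\{x,0\}$. Given a policy, $\{\boldsymbol{\chi}(n)\}$ is a controlled Markov chain whose transition law is the product of: the law of $h(n+1)$; the law of $Q(n+1)$ given $(Q(n),h(n),p(n))$ induced by $\lambda(n)$; and the law of $E(n+1)$ given $(E(n),p(n))$ induced by $\alpha(n)$. A control policy $\Omega$ chooses $p(n)$ as a function of $\{\boldsymbol{\chi}(i):0\le i\le n\}$ subject to the energy availability constraint $p(n)\tau\le E(n)$ for all $n$. It is admissible if (i) it is unichain (the controlled Markov chain has a single recurrent class and possibly some transient states) and (ii) $\lim_{n\to\infty}\mathbb{E}^{\Omega}[Q^2(n)]<\infty$. Here $\mathbb{E}^\Omega$ is expectation under the law induced by $\Omega$. The average delay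 cost is $\overline{D}(\Omega)=\limsup_{N\to\infty}\frac1N\sum_{n=0}^{N-1}\mathbb{E}^\Omega\big[Q(n)/\overline{\lambda}\big]$, and the problem is to minimize $\overline{D}(\Omega)$ over admissible policies.
   Formalization: In part (1), equality of θ* with the minimum is stated only if an admissible stationary policy attaining the minimum in the optimality equation exists (the hypothesis of (2)); without it only θ* ≤ D(Ω) is stated, as the literal (1) fails for V = −Q²/(2λ̄²τ), E[λ²] finite, where θ* < 0. *)

theory Defs
  imports "HOL-Probability.Probability"
begin

type_synonym state = "complex \<times> real \<times> real"

abbreviation channel :: "state \<Rightarrow> complex" where "channel x \<equiv> fst x"
abbreviation data_queue :: "state \<Rightarrow> real" where "data_queue x \<equiv> fst (snd x)"
abbreviation energy_queue :: "state \<Rightarrow> real" where "energy_queue x \<equiv> snd (snd x)"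

text \<open>The arrival processes enter only through the laws of one slot's data and energy arrival
  rates; arrivals and channels are independent of each other and i.i.d. over slots.\<close>

record eh_system =
  slot :: real
  capacity :: real
  data_law :: "real measure"
  energy_law :: "real measure"

definition mean_data :: "eh_system \<Rightarrow> real"
  where "mean_data S = (\<integral>l. l \<partial>data_law S)"

definition eh_model :: "eh_system \<Rightarrow> bool" where
  "eh_model S \<longleftrightarrow> 0 < slot S \<and> 0 \<le> capacity S \<and>
     prob_space (data_law S) \<and> sets (data_law S) = sets borel \<and>
     (AE l in data_law S. 0 \<le> l) \<and> integrable (data_law S) (\<lambda>l. l) \<and> 0 < mean_data S \<and>
     prob_space (energy_law S) \<and> sets (energy_law S) = sets borel \<and>
     (AE a in energy_law S. 0 \<le> a) \<and> integrable (energy_law S) (\<lambda>a. a)"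

definition state_space :: "eh_system \<Rightarrow> state set"
  where "state_space S = UNIV \<times> {0..} \<times> {0..capacity S}"

text \<open>The circularly symmetric law with \<open>E |h|\<^sup>2 = 1\<close>: real and imaginary parts are independent
  normal variables of mean 0 and variance 1/2 (the second argument of \<^const>\<open>normal_density\<close> is
  the standard deviation).\<close>

definition complex_normal :: "complex measure" where
  "complex_normal =
     (let N = density lborel (\<lambda>x. ennreal (normal_density 0 (sqrt (1/2)) x))
      in distr (N \<Otimes>\<^sub>M N) borel (\<lambda>(x, y). Complex x y))"

definition rate :: "complex \<Rightarrow> real \<Rightarrow> real"
  where "rate h p = ln (1 + p * (cmod h)\<^sup>2)"

definition next_data :: "eh_system \<Rightarrow> state \<Rightarrow> real \<Rightarrow> real \<Rightarrow> real" where
  "next_data S x p l = max (data_queue x - rate (channel x) p * slot S) 0 + l * slot S"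

definition next_energy :: "eh_system \<Rightarrow> state \<Rightarrow> real \<Rightarrow> real \<Rightarrow> real" where
  "next_energy S x p a = min (energy_queue x - p * slot S + a * slot S) (capacity S)"

text \<open>A policy \<open>\<pi>\<close> uses power \<open>\<pi> n \<xi>\<close> in slot \<open>n\<close>, where \<open>\<xi>\<close> is the state history restricted to
  the indices \<open>0, \<dots>, n\<close>.\<close>

type_synonym policy = "nat \<Rightarrow> (nat \<Rightarrow> state) \<Rightarrow> real"

definition control_policy :: "eh_system \<Rightarrow> policy \<Rightarrow> bool" where
  "control_policy S \<pi> \<longleftrightarrow>
     (\<forall>n. \<pi> n \<in> borel_measurable (Pi\<^sub>M {..n} (\<lambda>_. borel))) \<and>
     (\<forall>n. \<forall>\<xi> \<in> PiE {..n} (\<lambda>_. state_space S). 0 \<le> \<pi> n \<xi> \<and> \<pi> n \<xi> * slot S \<le> energy_queue (\<xi> n))"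

definition stationary :: "(state \<Rightarrow> real) \<Rightarrow> policy"
  where "stationary f = (\<lambda>n \<xi>. f (\<xi> n))"

text \<open>\<open>\<omega> n = (h (n+1), \<lambda> n, \<alpha> n)\<close> is the randomness of the transition from slot \<open>n\<close> to
  slot \<open>n + 1\<close>. Only the entries \<open>0, \<dots>, n\<close> of \<open>history S \<pi> x \<omega> n\<close> are meaningful.\<close>

definition noise :: "eh_system \<Rightarrow> (nat \<Rightarrow> complex \<times> real \<times> real) measure" where
  "noise S = Pi\<^sub>M UNIV (\<lambda>_. complex_normal \<Otimes>\<^sub>M (data_law S \<Otimes>\<^sub>M energy_law S))"

primrec history ::
  "eh_system \<Rightarrow> policy \<Rightarrow> state \<Rightarrow> (nat \<Rightarrow> complex \<times> real \<times> real) \<Rightarrow> nat \<Rightarrow> (nat \<Rightarrow> state)" where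
  "history S \<pi> x \<omega> 0 = (\<lambda>_. x)"
| "history S \<pi> x \<omega> (Suc n) =
     (let \<xi> = history S \<pi> x \<omega> n; p = \<pi> n (restrict \<xi> {..n}); (h, l, a) = \<omega> n
      in \<xi>(Suc n := (h, next_data S (\<xi> n) p l, next_energy S (\<xi> n) p a)))"

definition path_law :: "eh_system \<Rightarrow> policy \<Rightarrow> state measure \<Rightarrow> (nat \<Rightarrow> state) measure" where
  "path_law S \<pi> \<mu> =
     distr (\<mu> \<Otimes>\<^sub>M noise S) (Pi\<^sub>M UNIV (\<lambda>_. borel)) (\<lambda>(x, \<omega>) n. history S \<pi> x \<omega> n n)"

definition law_from_state :: "eh_system \<Rightarrow> policy \<Rightarrow> state \<Rightarrow> (nat \<Rightarrow> state) measure"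
  where "law_from_state S \<pi> x = path_law S \<pi> (return borel x)"

definition law_from_queues :: "eh_system \<Rightarrow> policy \<Rightarrow> real \<Rightarrow> real \<Rightarrow> (nat \<Rightarrow> state) measure"
  where "law_from_queues S \<pi> q e = path_law S \<pi> (distr complex_normal borel (\<lambda>h. (h, q, e)))"

text \<open>The state space is uncountable, so recurrence and transience are those of Markov chains on
  general state spaces (Meyn and Tweedie). A recurrent class is an absorbing Harris recurrent
  set; a set is transient if it is covered by countably many uniformly transient sets. For a
  stationary policy on a countable state space, \<open>unichain\<close> would say exactly that there is one
  recurrent class and that all other states are transient. For a history-dependent policy the
  same conditions are imposed on the laws of the controlled process started in slot 0.\<close>

definition recurrent_class :: "eh_system \<Rightarrow> policy \<Rightarrow> state set \<Rightarrow> bool" where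
  "recurrent_class S \<pi> H \<longleftrightarrow>
     H \<in> sets borel \<and> H \<subseteq> state_space S \<and>
     (\<forall>x\<in>H. AE \<xi> in law_from_state S \<pi> x. \<forall>n. \<xi> n \<in> H) \<and>
     (\<exists>\<phi>. prob_space \<phi> \<and> sets \<phi> = sets borel \<and> emeasure \<phi> H = 1 \<and>
        (\<forall>A\<in>sets borel. A \<subseteq> H \<longrightarrow> 0 < emeasure \<phi> A \<longrightarrow>
           (\<forall>x\<in>H. AE \<xi> in law_from_state S \<pi> x. \<exists>\<^sub>\<infinity>n. \<xi> n \<in> A)))"

definition uniformly_transient :: "eh_system \<Rightarrow> policy \<Rightarrow> state set \<Rightarrow> bool" where
  "uniformly_transient S \<pi> B \<longleftrightarrow>
     B \<in> sets borel \<and>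
     (\<exists>c<\<infinity>. \<forall>x\<in>state_space S.
        (\<integral>\<^sup>+\<xi>. (\<Sum>n. indicator B (\<xi> n)) \<partial>law_from_state S \<pi> x) \<le> c)"

definition transient_set :: "eh_system \<Rightarrow> policy \<Rightarrow> state set \<Rightarrow> bool" where
  "transient_set S \<pi> N \<longleftrightarrow>
     (\<exists>B :: nat \<Rightarrow> state set. (\<forall>i. uniformly_transient S \<pi> (B i)) \<and> N \<subseteq> (\<Union>i. B i))"

definition unichain :: "eh_system \<Rightarrow> policy \<Rightarrow> bool" where
  "unichain S \<pi> \<longleftrightarrow> (\<exists>H. recurrent_class S \<pi> H \<and> transient_set S \<pi> (state_space S - H))"

definition admissible :: "eh_system \<Rightarrow> policy \<Rightarrow> bool" where
  "admissible S \<pi> \<longleftrightarrow> control_policy S \<pi> \<and> unichain S \<pi> \<and>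
     (\<forall>q\<ge>0. \<forall>e\<in>{0..capacity S}. \<exists>c<\<infinity>.
        (\<lambda>n. \<integral>\<^sup>+\<xi>. ennreal ((data_queue (\<xi> n))\<^sup>2) \<partial>law_from_queues S \<pi> q e) \<longlonglongrightarrow> c)"

text \<open>The data queue in slot \<open>n\<close> is integrable under every control policy, since it is at most
  \<open>q\<close> plus the data that arrived in the first \<open>n\<close> slots.\<close>

definition avg_delay :: "eh_system \<Rightarrow> policy \<Rightarrow> real \<Rightarrow> real \<Rightarrow> ereal" where
  "avg_delay S \<pi> q e =
     limsup (\<lambda>N. ereal ((1 / real N) *
       (\<Sum>n<N. \<integral>\<xi>. data_queue (\<xi> n) / mean_data S \<partial>law_from_queues S \<pi> q e)))"

definition optimal_policy :: "eh_system \<Rightarrow> policy \<Rightarrow> bool" where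
  "optimal_policy S \<pi> \<longleftrightarrow> admissible S \<pi> \<and>
     (\<forall>\<pi>'. admissible S \<pi>' \<longrightarrow>
        (\<forall>q\<ge>0. \<forall>e\<in>{0..capacity S}. avg_delay S \<pi> q e \<le> avg_delay S \<pi>' q e))"

definition cost_to_go :: "eh_system \<Rightarrow> (real \<Rightarrow> real \<Rightarrow> real) \<Rightarrow> state \<Rightarrow> real \<Rightarrow> real" where
  "cost_to_go S V x p = data_queue x / mean_data S +
     (\<integral>(l, a). V (next_data S x p l) (next_energy S x p a) \<partial>(data_law S \<Otimes>\<^sub>M energy_law S))"

definition feasible :: "eh_system \<Rightarrow> state \<Rightarrow> real set"
  where "feasible S x = {0..energy_queue x / slot S}"

definition attains_min :: "eh_system \<Rightarrow> (real \<Rightarrow> real \<Rightarrow> real) \<Rightarrow> state \<Rightarrow> real \<Rightarrow> bool" where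
  "attains_min S V x p \<longleftrightarrow> p \<in> feasible S x \<and>
     (\<forall>p'\<in>feasible S x. cost_to_go S V x p \<le> cost_to_go S V x p')"

text \<open>All expectations in the equation are required to exist, and the minimum to be attained;
  the infimum below is then that minimum.\<close>

definition optimality_equation :: "eh_system \<Rightarrow> real \<Rightarrow> (real \<Rightarrow> real \<Rightarrow> real) \<Rightarrow> bool" where
  "optimality_equation S \<theta> V \<longleftrightarrow>
     (\<forall>x\<in>state_space S.
        (\<forall>p\<in>feasible S x. integrable (data_law S \<Otimes>\<^sub>M energy_law S)
           (\<lambda>(l, a). V (next_data S x p l) (next_energy S x p a))) \<and>
        (\<exists>p. attains_min S V x p)) \<and>
     (\<forall>q\<ge>0. \<forall>e\<in>{0..capacity S}.
        integrable complex_normal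
          (\<lambda>h. INF p\<in>feasible S (h, q, e). cost_to_go S V (h, q, e) p) \<and>
        \<theta> + V q e =
          (\<integral>h. (INF p\<in>feasible S (h, q, e). cost_to_go S V (h, q, e) p) \<partial>complex_normal))"

definition transversality :: "eh_system \<Rightarrow> (real \<Rightarrow> real \<Rightarrow> real) \<Rightarrow> policy \<Rightarrow> bool" where
  "transversality S V \<pi> \<longleftrightarrow>
     (\<forall>q\<ge>0. \<forall>e\<in>{0..capacity S}.
        (\<forall>N. integrable (law_from_queues S \<pi> q e)
           (\<lambda>\<xi>. V (data_queue (\<xi> N)) (energy_queue (\<xi> N)))) \<and>
        (\<lambda>N. (1 / real N) *
           (\<integral>\<xi>. V (data_queue (\<xi> N)) (energy_queue (\<xi> N)) \<partial>law_from_queues S \<pi> q e))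
          \<longlonglongrightarrow> 0)"

end

theory Submission
  imports Defs
begin

text \<open>Along any admissible policy, the expected cost-to-go of slot \<open>n\<close> is the expected delay cost of
  slot \<open>n\<close> plus \<open>E V(Q(n+1), E(n+1))\<close>. Since \<open>h(n)\<close> is independent of the queues of slot \<open>n\<close>,
  averaging over \<open>h(n)\<close> first and using the optimality equation bounds it below by
  \<open>\<theta> + E V(Q(n), E(n))\<close>, with equality if the power attains the minimum. Summing over the slots
  telescopes, and transversality removes the boundary terms. Independence enters as the fact that
  redrawing one coordinate of the underlying randomness does not change its law.\<close>

subsection \<open>Resampling\<close>

text \<open>Invariance of the law \<open>P\<close> under \<open>T\<close>, stated with iterated integrals instead of \<^const>\<open>distr\<close>
  because this form passes to products by rewriting.\<close>

definition resampling :: "'w measure \<Rightarrow> 'a measure \<Rightarrow> ('w \<Rightarrow> 'a \<Rightarrow> 'w) \<Rightarrow> bool" where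
  "resampling P A T \<longleftrightarrow> case_prod T \<in> measurable (P \<Otimes>\<^sub>M A) P \<and>
     (\<forall>g\<in>borel_measurable P. (\<integral>\<^sup>+w. g w \<partial>P) = (\<integral>\<^sup>+w. (\<integral>\<^sup>+a. g (T w a) \<partial>A) \<partial>P))"

lemma resamplingI:
  assumes "(\<lambda>u. T (fst u) (snd u)) \<in> measurable (P \<Otimes>\<^sub>M A) P"
    and "\<And>g. g \<in> borel_measurable P \<Longrightarrow> (\<integral>\<^sup>+w. (\<integral>\<^sup>+a. g (T w a) \<partial>A) \<partial>P) = (\<integral>\<^sup>+w. g w \<partial>P)"
  shows "resampling P A T"
  unfolding resampling_def case_prod_beta' using assms(1) assms(2)[symmetric] by blast

lemma resampling_measurable:
  "resampling P A T \<Longrightarrow> (\<lambda>(w, a). T w a) \<in> measurable (P \<Otimes>\<^sub>M A) P"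
  by (simp add: resampling_def)

lemma resampling_nn_integral:
  assumes "resampling P A T" "g \<in> borel_measurable P"
  shows "(\<integral>\<^sup>+w. (\<integral>\<^sup>+a. g (T w a) \<partial>A) \<partial>P) = (\<integral>\<^sup>+w. g w \<partial>P)"
  using assms by (auto simp: resampling_def)

text \<open>Indicators turn the defining identity into an equality of measures: \<open>T\<close>
  maps the product of \<open>P\<close> and \<open>A\<close> to \<open>P\<close>. In this form it
  transfers to integrands of either sign.\<close>

lemma resampling_distr:
  assumes T: "resampling P A T" and A: "prob_space A"
  shows "distr (P \<Otimes>\<^sub>M A) P (\<lambda>(w, a). T w a) = P"
proof (rule measure_eqI)
  interpret A: prob_space A by fact
  let ?T = "\<lambda>(w, a). T w a"
  note T_meas = resampling_measurable[OF T]
  fix X assume "X \<in> sets (distr (P \<Otimes>\<^sub>M A) P ?T)"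
  then have X: "X \<in> sets P" by simp
  then have ind: "indicator X \<in> borel_measurable P" by simp
  have "emeasure (distr (P \<Otimes>\<^sub>M A) P ?T) X = (\<integral>\<^sup>+w. indicator X w \<partial>distr (P \<Otimes>\<^sub>M A) P ?T)"
    using X by simp
  also have "\<dots> = (\<integral>\<^sup>+u. indicator X (?T u) \<partial>(P \<Otimes>\<^sub>M A))"
    by (rule nn_integral_distr[OF T_meas]) (use X in simp)
  also have "\<dots> = (\<integral>\<^sup>+w. (\<integral>\<^sup>+a. indicator X (T w a) \<partial>A) \<partial>P)"
    using A.nn_integral_fst[OF measurable_compose[OF T_meas ind]] by simp
  also have "\<dots> = emeasure P X"
    using resampling_nn_integral[OF T ind] X by simp
  finally show "emeasure (distr (P \<Otimes>\<^sub>M A) P ?T) X = emeasure P X" .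
qed simp

text \<open>Integrability moves from \<open>P\<close> to the product through the image measure, and
  Fubini splits the product again. Sections are then integrable only for almost every
  \<open>w\<close>, which is why later comparisons hold almost everywhere.\<close>

lemma resampling_integral:
  fixes f :: "'w \<Rightarrow> real"
  assumes T: "resampling P A T" and P: "prob_space P" and A: "prob_space A" and f: "integrable P f"
  shows "AE w in P. integrable A (\<lambda>a. f (T w a))"
    and "integrable P (\<lambda>w. \<integral>a. f (T w a) \<partial>A)"
    and "(\<integral>w. (\<integral>a. f (T w a) \<partial>A) \<partial>P) = (\<integral>w. f w \<partial>P)"
proof -
  interpret P: prob_space P by fact
  interpret A: prob_space A by fact
  interpret pair_sigma_finite P A ..
  note T_meas = resampling_measurable[OF T]
  have "integrable (distr (P \<Otimes>\<^sub>M A) P (\<lambda>(w, a). T w a)) f"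
    using f by (simp add: resampling_distr[OF T A])
  then have int: "integrable (P \<Otimes>\<^sub>M A) (\<lambda>u. f ((\<lambda>(w, a). T w a) u))"
    by (rule integrable_distr[OF T_meas])
  show "AE w in P. integrable A (\<lambda>a. f (T w a))"
    using AE_integrable_fst'[OF int] by simp
  show "integrable P (\<lambda>w. \<integral>a. f (T w a) \<partial>A)"
    using integrable_fst'[OF int] by simp
  have "(\<integral>w. (\<integral>a. f (T w a) \<partial>A) \<partial>P) = (\<integral>u. f ((\<lambda>(w, a). T w a) u) \<partial>(P \<Otimes>\<^sub>M A))"
    using integral_fst'[OF int] by simp
  also have "\<dots> = (\<integral>w. f w \<partial>(distr (P \<Otimes>\<^sub>M A) P (\<lambda>(w, a). T w a)))"
    by (rule integral_distr[symmetric, OF T_meas]) (use f in auto)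
  finally show "(\<integral>w. (\<integral>a. f (T w a) \<partial>A) \<partial>P) = (\<integral>w. f w \<partial>P)"
    by (simp add: resampling_distr[OF T A])
qed

section \<open>Redrawing one coordinate of a finite or infinite product\<close>

lemma resampling_fst:
  assumes "prob_space A" "prob_space B"
  shows "resampling (A \<Otimes>\<^sub>M B) A (\<lambda>u a. (a, snd u))"
proof (rule resamplingI)
  interpret A: prob_space A by fact
  interpret B: prob_space B by fact
  interpret pair_sigma_finite A B ..
  show "(\<lambda>u. (snd u, snd (fst u))) \<in> measurable ((A \<Otimes>\<^sub>M B) \<Otimes>\<^sub>M A) (A \<Otimes>\<^sub>M B)"
    by simp
  fix g :: "_ \<Rightarrow> ennreal" assume [measurable]: "g \<in> borel_measurable (A \<Otimes>\<^sub>M B)"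
  have "(\<integral>\<^sup>+u. (\<integral>\<^sup>+a. g (a, snd u) \<partial>A) \<partial>(A \<Otimes>\<^sub>M B)) = (\<integral>\<^sup>+x. (\<integral>\<^sup>+y. (\<integral>\<^sup>+a. g (a, y) \<partial>A) \<partial>B) \<partial>A)"
    by (subst B.nn_integral_fst[symmetric]) auto
  \<comment> \<open>The discarded coordinate integrates to its mass 1, and Tonelli restores the
    order of the other two.\<close>
  also have "\<dots> = (\<integral>\<^sup>+u. g u \<partial>(A \<Otimes>\<^sub>M B))"
    by (simp add: A.emeasure_space_1 nn_integral_snd[of "\<lambda>(a, b). g (a, b)", simplified])
  finally show "(\<integral>\<^sup>+u. (\<integral>\<^sup>+a. g (a, snd u) \<partial>A) \<partial>(A \<Otimes>\<^sub>M B)) = (\<integral>\<^sup>+u. g u \<partial>(A \<Otimes>\<^sub>M B))" .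
qed

text \<open>For each fixed first coordinate the hypothesis applies to the section of the integrand.
  This lifts a redraw inside the noise to the whole sample space.\<close>

lemma resampling_pair_snd:
  assumes T: "resampling B A T" and "prob_space A" "prob_space B"
  shows "resampling (C \<Otimes>\<^sub>M B) A (\<lambda>u a. (fst u, T (snd u) a))"
proof (rule resamplingI)
  interpret A: prob_space A by fact
  interpret B: prob_space B by fact
  note T_meas[measurable] = resampling_measurable[OF T]
  show "(\<lambda>u. (fst (fst u), T (snd (fst u)) (snd u))) \<in> measurable ((C \<Otimes>\<^sub>M B) \<Otimes>\<^sub>M A) (C \<Otimes>\<^sub>M B)"
    by simp
  fix g :: "_ \<Rightarrow> ennreal" assume [measurable]: "g \<in> borel_measurable (C \<Otimes>\<^sub>M B)"
  have "(\<integral>\<^sup>+u. (\<integral>\<^sup>+a. g (fst u, T (snd u) a) \<partial>A) \<partial>(C \<Otimes>\<^sub>M B))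
      = (\<integral>\<^sup>+x. (\<integral>\<^sup>+y. (\<integral>\<^sup>+a. g (x, T y a) \<partial>A) \<partial>B) \<partial>C)"
    by (subst B.nn_integral_fst[symmetric]) auto
  also have "\<dots> = (\<integral>\<^sup>+x. (\<integral>\<^sup>+y. g (x, y) \<partial>B) \<partial>C)"
    by (intro nn_integral_cong resampling_nn_integral[OF T, of "\<lambda>y. g (_, y)"]) measurable
  also have "\<dots> = (\<integral>\<^sup>+u. g u \<partial>(C \<Otimes>\<^sub>M B))"
    by (subst B.nn_integral_fst) auto
  finally show "(\<integral>\<^sup>+u. (\<integral>\<^sup>+a. g (fst u, T (snd u) a) \<partial>A) \<partial>(C \<Otimes>\<^sub>M B)) = (\<integral>\<^sup>+u. g u \<partial>(C \<Otimes>\<^sub>M B))" .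
qed

lemma resampling_snd:
  assumes A: "prob_space A"
  shows "resampling (B \<Otimes>\<^sub>M A) A (\<lambda>u a. (fst u, a))"
proof -
  interpret A: prob_space A by fact
  have "resampling A A (\<lambda>_ a. a)"
    by (auto simp: resampling_def A.emeasure_space_1)
  from resampling_pair_snd[OF this A A] show ?thesis .
qed

text \<open>Splitting off coordinate \<open>k\<close> presents the full product as an image of
  \<open>M\<close> times the product over the other indices. There the old value at \<open>k\<close>
  is overwritten, and Fubini moves the fresh value into its place.\<close>

lemma resampling_PiM_component:
  fixes M :: "'a measure" and k :: 'i
  assumes M: "prob_space M"
  shows "resampling (\<Pi>\<^sub>M i\<in>UNIV. M) M (\<lambda>\<xi> z. \<xi>(k := z))"
proof (rule resamplingI)
  let ?N = "\<Pi>\<^sub>M i\<in>(UNIV :: 'i set). M" and ?K = "\<Pi>\<^sub>M i\<in>UNIV - {k}. M"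
  interpret M: prob_space M by fact
  interpret K: prob_space ?K by (rule prob_space_PiM) (rule M)
  interpret pair_sigma_finite M ?K ..
  have upd: "(\<lambda>u. (snd u)(k := fst u)) \<in> measurable (M \<Otimes>\<^sub>M ?K) ?N"
    by (rule measurable_fun_upd[where J = "UNIV - {k}"]) auto
  have N: "distr (M \<Otimes>\<^sub>M ?K) ?N (\<lambda>u. (snd u)(k := fst u)) = ?N"
    using distr_pair_PiM_eq_PiM[of "UNIV - {k}" "\<lambda>_. M" k] M
    by (simp add: case_prod_beta' insert_absorb)
  show upd': "(\<lambda>u. (fst u)(k := snd u)) \<in> measurable (?N \<Otimes>\<^sub>M M) ?N"
    by (rule measurable_fun_upd[where J = UNIV]) auto
  fix g :: "('i \<Rightarrow> 'a) \<Rightarrow> ennreal" assume g: "g \<in> borel_measurable ?N"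
  note g_upd = measurable_compose[OF upd g] and g_upd' = measurable_compose[OF upd' g]
  have I: "(\<integral>\<^sup>+\<xi>. f \<xi> \<partial>?N) = (\<integral>\<^sup>+x. (\<integral>\<^sup>+X. f (X(k := x)) \<partial>?K) \<partial>M)"
    if f: "f \<in> borel_measurable ?N" for f :: "('i \<Rightarrow> 'a) \<Rightarrow> ennreal"
  proof -
    have "(\<integral>\<^sup>+\<xi>. f \<xi> \<partial>?N) = (\<integral>\<^sup>+u. f ((snd u)(k := fst u)) \<partial>(M \<Otimes>\<^sub>M ?K))"
      using nn_integral_distr[OF upd, of f] f by (simp add: N)
    also have "\<dots> = (\<integral>\<^sup>+x. (\<integral>\<^sup>+X. f (X(k := x)) \<partial>?K) \<partial>M)"
      using K.nn_integral_fst[OF measurable_compose[OF upd f]] by simp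
    finally show ?thesis .
  qed
  have "(\<lambda>\<xi>. \<integral>\<^sup>+z. g (\<xi>(k := z)) \<partial>M) \<in> borel_measurable ?N"
    using M.borel_measurable_nn_integral_fst[OF g_upd'] by simp
  then have "(\<integral>\<^sup>+\<xi>. (\<integral>\<^sup>+z. g (\<xi>(k := z)) \<partial>M) \<partial>?N)
      = (\<integral>\<^sup>+x. (\<integral>\<^sup>+X. (\<integral>\<^sup>+z. g (X(k := z)) \<partial>M) \<partial>?K) \<partial>M)"
    by (subst I) (assumption, simp only: fun_upd_upd)
  \<comment> \<open>The integrand is constant in the old value \<open>x\<close>, whose law has mass
    1.\<close>
  also have "\<dots> = (\<integral>\<^sup>+X. (\<integral>\<^sup>+z. g (X(k := z)) \<partial>M) \<partial>?K)"
    by (simp add: M.emeasure_space_1)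
  also have "\<dots> = (\<integral>\<^sup>+z. (\<integral>\<^sup>+X. g (X(k := z)) \<partial>?K) \<partial>M)"
    using Fubini[OF g_upd] by simp
  also have "\<dots> = (\<integral>\<^sup>+\<xi>. g \<xi> \<partial>?N)" by (rule I[OF g, symmetric])
  finally show "(\<integral>\<^sup>+\<xi>. (\<integral>\<^sup>+z. g (\<xi>(k := z)) \<partial>M) \<partial>?N) = (\<integral>\<^sup>+\<xi>. g \<xi> \<partial>?N)" .
qed

text \<open>First redraw the whole coordinate, so that \<open>T\<close> acts on a fresh
  \<open>z\<close> of law \<open>M\<close>; then invariance of \<open>M\<close> under
  \<open>T\<close> removes \<open>T\<close>; then undo the full redraw. This allows redrawing only a
  part of one entry, such as its channel or its arrivals.\<close>

lemma resampling_PiM: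
  fixes M :: "'a measure" and k :: 'i
  assumes M: "prob_space M" and A: "prob_space A" and T: "resampling M A T"
  shows "resampling (\<Pi>\<^sub>M i\<in>UNIV. M) A (\<lambda>\<xi> a. \<xi>(k := T (\<xi> k) a))"
proof (rule resamplingI)
  let ?N = "\<Pi>\<^sub>M i\<in>(UNIV :: 'i set). M"
  interpret A: prob_space A by fact
  interpret M: prob_space M by fact
  note R = resampling_PiM_component[OF M, of k]
  have T_meas[measurable]: "(\<lambda>(w, a). T w a) \<in> measurable (M \<Otimes>\<^sub>M A) M"
    by (rule resampling_measurable[OF T])
  show upd1: "(\<lambda>u. (fst u)(k := T (fst u k) (snd u))) \<in> measurable (?N \<Otimes>\<^sub>M A) ?N"
    by (rule measurable_fun_upd[where J = UNIV]) auto
  have upd_comp: "(\<lambda>z. \<xi>(k := z)) \<in> measurable M ?N" if "\<xi> \<in> space ?N" for \<xi>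
    by (rule measurable_fun_upd[where J = UNIV]) (use that in auto)
  fix g :: "('i \<Rightarrow> 'a) \<Rightarrow> ennreal" assume g: "g \<in> borel_measurable ?N"
  have "(\<lambda>\<xi>. \<integral>\<^sup>+a. g (\<xi>(k := T (\<xi> k) a)) \<partial>A) \<in> borel_measurable ?N"
    using A.borel_measurable_nn_integral_fst[OF measurable_compose[OF upd1 g]] by simp
  from resampling_nn_integral[OF R this]
  have "(\<integral>\<^sup>+\<xi>. (\<integral>\<^sup>+a. g (\<xi>(k := T (\<xi> k) a)) \<partial>A) \<partial>?N)
      = (\<integral>\<^sup>+\<xi>. (\<integral>\<^sup>+z. (\<integral>\<^sup>+a. g (\<xi>(k := T z a)) \<partial>A) \<partial>M) \<partial>?N)"
    by (simp only: fun_upd_upd fun_upd_same)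
  also have "\<dots> = (\<integral>\<^sup>+\<xi>. (\<integral>\<^sup>+z. g (\<xi>(k := z)) \<partial>M) \<partial>?N)"
    using measurable_compose[OF upd_comp g]
    by (intro nn_integral_cong resampling_nn_integral[OF T, of "\<lambda>z. g (_(k := z))"])
  also have "\<dots> = (\<integral>\<^sup>+\<xi>. g \<xi> \<partial>?N)"
    by (rule resampling_nn_integral[OF R g])
  finally show "(\<integral>\<^sup>+\<xi>. (\<integral>\<^sup>+a. g (\<xi>(k := T (\<xi> k) a)) \<partial>A) \<partial>?N) = (\<integral>\<^sup>+\<xi>. g \<xi> \<partial>?N)" .
qed

subsection \<open>The controlled queues\<close>

lemma sets_complex_normal [measurable_cong, simp]: "sets complex_normal = sets borel"
  by (simp add: complex_normal_def Let_def)

lemma prob_space_complex_normal: "prob_space complex_normal"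
proof -
  let ?N = "density lborel (\<lambda>x. ennreal (normal_density 0 (sqrt (1/2)) x))"
  interpret N: prob_space ?N by (rule prob_space_normal_density) simp
  interpret pair_prob_space ?N ?N ..
  show ?thesis
    unfolding complex_normal_def Let_def case_prod_beta' Complex_eq
    by (rule prob_space_distr) measurable
qed

lemma borel_state: "(borel :: state measure) = borel \<Otimes>\<^sub>M (borel \<Otimes>\<^sub>M borel)"
  by (simp add: borel_prod)

lemma measurable_borel_stateI:
  assumes "f \<in> borel_measurable M" "g \<in> borel_measurable M" "h \<in> borel_measurable M"
  shows "(\<lambda>x. (f x, g x, h x) :: state) \<in> borel_measurable M"
  using assms unfolding borel_state by measurable

lemma distr_pair_snd:
  assumes "prob_space A" "prob_space B"
  shows "distr (A \<Otimes>\<^sub>M B) B snd = B"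
proof (rule measure_eqI)
  interpret A: prob_space A by fact
  interpret B: prob_space B by fact
  fix X assume X: "X \<in> sets (distr (A \<Otimes>\<^sub>M B) B snd)"
  then have "snd -` X \<inter> space (A \<Otimes>\<^sub>M B) = space A \<times> X"
    by (auto simp: space_pair_measure dest: sets.sets_into_space)
  with X show "emeasure (distr (A \<Otimes>\<^sub>M B) B snd) X = emeasure B X"
    by (simp add: emeasure_distr B.emeasure_pair_measure_Times A.emeasure_space_1)
qed simp

lemma distr_compose_eq:
  assumes "distr M N f = N" "distr N L g = L" "f \<in> measurable M N" "g \<in> measurable N L"
  shows "distr M L (\<lambda>x. g (f x)) = L"
  using distr_distr[OF assms(4,3)] assms(1,2) by (simp add: comp_def)

lemma measurable_triple_components:
  assumes x: "x \<in> measurable M (A \<Otimes>\<^sub>M (B \<Otimes>\<^sub>M C))"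
  shows "(\<lambda>u. fst (x u)) \<in> measurable M A" "(\<lambda>u. fst (snd (x u))) \<in> measurable M B"
    "(\<lambda>u. snd (snd (x u))) \<in> measurable M C"
proof -
  note snd_x = measurable_compose[OF x measurable_snd]
  show "(\<lambda>u. fst (x u)) \<in> measurable M A" by (rule measurable_compose[OF x measurable_fst])
  show "(\<lambda>u. fst (snd (x u))) \<in> measurable M B" by (rule measurable_compose[OF snd_x measurable_fst])
  show "(\<lambda>u. snd (snd (x u))) \<in> measurable M C" by (rule measurable_compose[OF snd_x measurable_snd])
qed

lemma measurable_state_components:
  assumes "x \<in> measurable M (borel :: state measure)"
  shows "(\<lambda>u. channel (x u)) \<in> borel_measurable M" "(\<lambda>u. data_queue (x u)) \<in> borel_measurable M"
    "(\<lambda>u. energy_queue (x u)) \<in> borel_measurable M"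
  by (rule measurable_triple_components[OF assms[unfolded borel_state]])+

lemma measurable_next_queues:
  assumes "x \<in> borel_measurable M" "p \<in> borel_measurable M"
    and [measurable]: "l \<in> borel_measurable M" "a \<in> borel_measurable M"
  shows "(\<lambda>u. next_data S (x u) (p u) (l u)) \<in> borel_measurable M"
    and "(\<lambda>u. next_energy S (x u) (p u) (a u)) \<in> borel_measurable M"
proof -
  note [measurable] = assms(2) measurable_state_components[OF assms(1)]
  show "(\<lambda>u. next_data S (x u) (p u) (l u)) \<in> borel_measurable M"
    "(\<lambda>u. next_energy S (x u) (p u) (a u)) \<in> borel_measurable M"
    unfolding next_data_def next_energy_def rate_def by measurable
qed

text \<open>The states of slots \<open>0\<close> to \<open>n\<close> are built from the noise
  entries below \<open>n\<close>; entry \<open>n\<close> first acts in the step to slot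
  \<open>n + 1\<close>. This is the causality of the control.\<close>

lemma history_fun_upd: "n \<le> k \<Longrightarrow> history S \<pi> x (\<xi>(k := z)) n = history S \<pi> x \<xi> n"
  by (induction n) (auto simp: Let_def)

section \<open>The process under one policy from one pair of initial queues\<close>

locale controlled_queues =
  fixes S :: eh_system and \<pi> :: policy and q e :: real
  assumes model: "eh_model S" and policy: "control_policy S \<pi>"
    and q_nonneg: "0 \<le> q" and e_bounds: "e \<in> {0..capacity S}"
begin

abbreviation "arrivals \<equiv> data_law S \<Otimes>\<^sub>M energy_law S"
abbreviation "slot_law \<equiv> complex_normal \<Otimes>\<^sub>M arrivals"
text \<open>The first coordinate is the channel of slot \<open>0\<close>. All states and powers
  become functions on this one probability space, so that randomness can be redrawn coordinate by
  coordinate.\<close>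

abbreviation "P \<equiv> complex_normal \<Otimes>\<^sub>M noise S"

definition "hist n w = history S \<pi> (fst w, q, e) (snd w) n"
definition "tx_power n w = \<pi> n (restrict (hist n w) {..n})"
abbreviation "X n w \<equiv> hist n w n"

lemma prob_space_data: "prob_space (data_law S)" and prob_space_energy: "prob_space (energy_law S)"
  and sets_data [measurable_cong, simp]: "sets (data_law S) = sets borel"
  and sets_energy [measurable_cong, simp]: "sets (energy_law S) = sets borel"
  and slot_pos: "0 < slot S"
  and integrable_data: "integrable (data_law S) (\<lambda>l. l)"
  and AE_data: "AE l in data_law S. 0 \<le> l" and AE_energy: "AE a in energy_law S. 0 \<le> a"
  using model by (auto simp: eh_model_def)

sublocale channel: prob_space complex_normal by (rule prob_space_complex_normal)
sublocale data: prob_space "data_law S" by (rule prob_space_data)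
sublocale energy: prob_space "energy_law S" by (rule prob_space_energy)
sublocale arrivals: pair_prob_space "data_law S" "energy_law S" ..

lemma prob_space_arrivals: "prob_space arrivals"
  by unfold_locales

lemma prob_space_slot_law: "prob_space slot_law"
proof -
  interpret pair_prob_space complex_normal arrivals ..
  show ?thesis by unfold_locales
qed

lemma prob_space_noise: "prob_space (noise S)"
  unfolding noise_def by (intro prob_space_PiM prob_space_slot_law)

lemma prob_space_P: "prob_space P"
proof -
  interpret noise: prob_space "noise S" by (rule prob_space_noise)
  interpret pair_prob_space complex_normal "noise S" ..
  show ?thesis by unfold_locales
qed

lemma X_0: "X 0 w = (fst w, q, e)"
  by (simp add: hist_def)

lemma hist_Suc: "hist (Suc n) w =
    (hist n w)(Suc n := (fst (snd w n),
       next_data S (X n w) (tx_power n w) (fst (snd (snd w n))),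
       next_energy S (X n w) (tx_power n w) (snd (snd (snd w n)))))"
  by (simp add: hist_def tx_power_def Let_def case_prod_beta')

lemma measurable_noise_component [measurable]: "(\<lambda>\<xi>. \<xi> n) \<in> measurable (noise S) slot_law"
  unfolding noise_def by measurable

text \<open>The induction runs over all \<open>k\<close> at once, because the power of slot
  \<open>n\<close> reads the whole history up to \<open>n\<close>.\<close>

lemma measurable_history [measurable]:
  "(\<lambda>u. history S \<pi> (fst u) (snd u) n k) \<in> borel_measurable (borel \<Otimes>\<^sub>M noise S)"
proof (induction n arbitrary: k)
  case 0
  show ?case by simp
next
  case (Suc n)
  let ?\<xi> = "\<lambda>u. history S \<pi> (fst u) (snd u) n"
  note [measurable] = Suc.IH
  have "(\<lambda>u. restrict (?\<xi> u) {..n}) \<in> measurable (borel \<Otimes>\<^sub>M noise S) (Pi\<^sub>M {..n} (\<lambda>_. borel))"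
    by (rule measurable_restrict) simp
  from measurable_compose[OF this] policy
  have p: "(\<lambda>u. \<pi> n (restrict (?\<xi> u) {..n})) \<in> borel_measurable (borel \<Otimes>\<^sub>M noise S)"
    by (auto simp: control_policy_def)
  note noise_n = measurable_triple_components[OF measurable_compose[OF measurable_snd measurable_noise_component[of n]]]
  have h: "(\<lambda>u. fst (snd u n)) \<in> borel_measurable (borel \<Otimes>\<^sub>M noise S)"
    and l: "(\<lambda>u. fst (snd (snd u n))) \<in> borel_measurable (borel \<Otimes>\<^sub>M noise S)"
    and a: "(\<lambda>u. snd (snd (snd u n))) \<in> borel_measurable (borel \<Otimes>\<^sub>M noise S)"
    using noise_n by (auto cong: measurable_cong_sets)
  note step = measurable_borel_stateI[OF h measurable_next_queues[OF Suc.IH[of n] p l a]]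
  show ?case
  proof (cases "k = Suc n")
    case True
    then show ?thesis using step by (simp add: Let_def case_prod_beta')
  next
    case False
    then show ?thesis using Suc.IH[of k] by (simp add: Let_def case_prod_beta')
  qed
qed

lemma measurable_start: "(\<lambda>w. ((fst w, q, e), snd w)) \<in> measurable P (borel \<Otimes>\<^sub>M noise S)"
  by (intro measurable_Pair measurable_borel_stateI) auto

lemma measurable_hist [measurable]: "(\<lambda>w. hist n w k) \<in> borel_measurable P"
  using measurable_compose[OF measurable_start measurable_history[of n k]] by (simp add: hist_def)

lemma measurable_queues [measurable]:
  "(\<lambda>w. data_queue (X n w)) \<in> borel_measurable P" "(\<lambda>w. energy_queue (X n w)) \<in> borel_measurable P"
  by (rule measurable_state_components[OF measurable_hist])+

lemma law_from_queues_eq: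
  "law_from_queues S \<pi> q e = distr P (Pi\<^sub>M UNIV (\<lambda>_. borel)) (\<lambda>w n. X n w)"
proof -
  interpret noise: prob_space "noise S" by (rule prob_space_noise)
  let ?start = "\<lambda>h. (h, q, e) :: state"
  have start[measurable]: "?start \<in> measurable complex_normal borel"
    by (intro measurable_borel_stateI) auto
  \<comment> \<open>Writing the noise law as its own image under the identity makes the product an
    image of \<open>P\<close>.\<close>
  have "distr complex_normal borel ?start \<Otimes>\<^sub>M noise S
      = distr complex_normal borel ?start \<Otimes>\<^sub>M distr (noise S) (noise S) (\<lambda>\<xi>. \<xi>)"
    by (simp add: distr_id2)
  also have "\<dots> = distr P (borel \<Otimes>\<^sub>M noise S) (\<lambda>(h, \<xi>). (?start h, \<xi>))"
    by (rule pair_measure_distr) (auto simp: distr_id2 intro: noise.sigma_finite_measure_axioms)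
  finally have *: "distr complex_normal borel ?start \<Otimes>\<^sub>M noise S
      = distr P (borel \<Otimes>\<^sub>M noise S) (\<lambda>(h, \<xi>). (?start h, \<xi>))" .
  show ?thesis
    unfolding law_from_queues_def path_law_def *
    by (subst distr_distr; (simp add: case_prod_beta' comp_def hist_def)?)
      (auto intro!: measurable_PiM_single' measurable_start)
qed

text \<open>Measurability is asked of \<open>g\<close> along the path, since this is the form in
  which it is available for the value function, from the integrability contained in
  \<open>transversality\<close>.\<close>

lemma integral_law_from_queues:
  fixes g :: "state \<Rightarrow> real"
  assumes "(\<lambda>\<xi>. g (\<xi> n)) \<in> borel_measurable (Pi\<^sub>M UNIV (\<lambda>_. borel :: state measure))"
  shows "(\<integral>\<xi>. g (\<xi> n) \<partial>law_from_queues S \<pi> q e) = (\<integral>w. g (X n w) \<partial>P)"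
    and "integrable (law_from_queues S \<pi> q e) (\<lambda>\<xi>. g (\<xi> n)) \<longleftrightarrow> integrable P (\<lambda>w. g (X n w))"
proof -
  have X: "(\<lambda>w n. X n w) \<in> measurable P (Pi\<^sub>M UNIV (\<lambda>_. borel))"
    by (rule measurable_PiM_single') (auto intro: measurable_hist)
  show "(\<integral>\<xi>. g (\<xi> n) \<partial>law_from_queues S \<pi> q e) = (\<integral>w. g (X n w) \<partial>P)"
    unfolding law_from_queues_eq by (rule integral_distr[OF X assms])
  show "integrable (law_from_queues S \<pi> q e) (\<lambda>\<xi>. g (\<xi> n)) \<longleftrightarrow> integrable P (\<lambda>w. g (X n w))"
    unfolding law_from_queues_eq by (rule integrable_distr_eq[OF X assms])
qed

text \<open>The arrival laws guarantee nonnegative rates only almost surely, so pathwise claims are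
  made on this event, which has probability 1.\<close>

definition nonneg_arrivals :: "(nat \<Rightarrow> complex \<times> real \<times> real) \<Rightarrow> bool" where
  "nonneg_arrivals \<xi> \<longleftrightarrow> (\<forall>n. 0 \<le> fst (snd (\<xi> n)) \<and> 0 \<le> snd (snd (\<xi> n)))"

lemma distr_noise: "distr P (noise S) snd = noise S"
  by (rule distr_pair_snd[OF prob_space_complex_normal prob_space_noise])

lemma distr_arrivals: "distr P arrivals (\<lambda>w. snd (snd w n)) = arrivals"
proof (rule distr_compose_eq[OF _ distr_pair_snd[OF prob_space_complex_normal prob_space_arrivals]])
  show "distr P slot_law (\<lambda>w. snd w n) = slot_law"
    using distr_compose_eq[OF distr_noise distr_PiM_component[of UNIV "\<lambda>_. slot_law" n, folded noise_def]]
    by (simp add: prob_space_slot_law)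
qed (auto intro: measurable_compose[OF measurable_snd measurable_noise_component])

lemma measurable_arrivals: "(\<lambda>w. snd (snd w n)) \<in> measurable P arrivals"
  by measurable

lemma distr_data_arrival: "distr P (data_law S) (\<lambda>w. fst (snd (snd w n))) = data_law S"
  by (rule distr_compose_eq[OF distr_arrivals energy.distr_pair_fst measurable_arrivals]) simp

lemma distr_energy_arrival: "distr P (energy_law S) (\<lambda>w. snd (snd (snd w n))) = energy_law S"
  by (rule distr_compose_eq[OF distr_arrivals distr_pair_snd[OF prob_space_data prob_space_energy]
        measurable_arrivals]) simp

lemma AE_nonneg_arrivals: "AE w in P. nonneg_arrivals (snd w)"
proof -
  have "AE w in P. 0 \<le> fst (snd (snd w n))" for n
    by (rule AE_distrD[OF measurable_compose[OF measurable_arrivals measurable_fst]])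
      (unfold distr_data_arrival, rule AE_data)
  moreover have "AE w in P. 0 \<le> snd (snd (snd w n))" for n
    by (rule AE_distrD[OF measurable_compose[OF measurable_arrivals measurable_snd]])
      (unfold distr_energy_arrival, rule AE_energy)
  ultimately show ?thesis
    by (simp add: nonneg_arrivals_def AE_all_countable)
qed

lemma power_feasible:
  assumes "\<And>k. hist n w k \<in> state_space S"
  shows "tx_power n w \<in> feasible S (X n w)" "0 \<le> tx_power n w"
    "tx_power n w * slot S \<le> energy_queue (X n w)"
proof -
  have "restrict (hist n w) {..n} \<in> PiE {..n} (\<lambda>_. state_space S)"
    using assms by auto
  then have "0 \<le> tx_power n w \<and> tx_power n w * slot S \<le> energy_queue (restrict (hist n w) {..n} n)"
    using policy unfolding control_policy_def tx_power_def by blast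
  then show "0 \<le> tx_power n w" "tx_power n w * slot S \<le> energy_queue (X n w)"
    by simp_all
  then show "tx_power n w \<in> feasible S (X n w)"
    using slot_pos by (simp add: feasible_def field_simps)
qed

text \<open>The energy constraint keeps the battery nonnegative before the arrival is added, and the
  cap bounds it above. All \<open>k\<close> can be covered because entries beyond the current slot
  still hold the initial state.\<close>

lemma hist_in_state_space:
  assumes "nonneg_arrivals (snd w)"
  shows "hist n w k \<in> state_space S"
proof (induction n arbitrary: k)
  case 0
  then show ?case using q_nonneg e_bounds by (simp add: hist_def state_space_def)
next
  case (Suc n)
  let ?l = "fst (snd (snd w n))" and ?a = "snd (snd (snd w n))"
  have "0 \<le> ?l * slot S" "0 \<le> ?a * slot S"
    using assms slot_pos by (simp_all add: nonneg_arrivals_def)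
  moreover have "0 \<le> capacity S" using e_bounds by simp
  ultimately have "0 \<le> next_data S (X n w) (tx_power n w) ?l"
    "next_energy S (X n w) (tx_power n w) ?a \<in> {0..capacity S}"
    using power_feasible(3)[OF Suc.IH] by (auto simp: next_data_def next_energy_def)
  then show ?case using Suc.IH[of k] by (simp add: hist_Suc state_space_def)
qed

text \<open>Feasible powers give nonnegative rates, so service only shrinks the queue and each slot
  adds at most its arrival, which has finite mean.\<close>

lemma integrable_data_queue: "integrable P (\<lambda>w. data_queue (X n w))"
proof (induction n)
  case 0
  interpret prob_space P by (rule prob_space_P)
  show ?case by (simp add: X_0)
next
  case (Suc n)
  have l: "integrable P (\<lambda>w. fst (snd (snd w n)))"
    by (rule integrable_distr[OF measurable_compose[OF measurable_arrivals measurable_fst]])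
      (simp add: distr_data_arrival integrable_data)
  show ?case
  proof (rule Bochner_Integration.integrable_bound)
    show "integrable P (\<lambda>w. \<bar>data_queue (X n w)\<bar> + \<bar>fst (snd (snd w n))\<bar> * slot S)"
      using Suc.IH l by simp
    show "AE w in P. norm (data_queue (X (Suc n) w))
        \<le> norm (\<bar>data_queue (X n w)\<bar> + \<bar>fst (snd (snd w n))\<bar> * slot S)"
      using AE_nonneg_arrivals
    proof eventually_elim
      case (elim w)
      have "0 \<le> tx_power n w" using power_feasible(2) hist_in_state_space[OF elim] by blast
      then have "0 \<le> rate (channel (X n w)) (tx_power n w) * slot S"
        using slot_pos by (simp add: rate_def)
      moreover have "0 \<le> fst (snd (snd w n)) * slot S"
        using elim slot_pos by (simp add: nonneg_arrivals_def)
      ultimately show ?case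
        using elim slot_pos by (simp add: hist_Suc next_data_def nonneg_arrivals_def)
    qed
  qed measurable
qed

subsection \<open>Drift of the relative value function\<close>

definition cost :: "(real \<Rightarrow> real \<Rightarrow> real) \<Rightarrow> nat \<Rightarrow> complex \<times> (nat \<Rightarrow> complex \<times> real \<times> real) \<Rightarrow> real" where
  "cost V n w = cost_to_go S V (X n w) (tx_power n w)"

text \<open>Entry \<open>n\<close> also stores the channel of slot \<open>n + 1\<close>. It is kept,
  since \<open>cost_to_go\<close> averages over the arrivals alone.\<close>

definition resample_arrivals where
  "resample_arrivals n w d = (fst w, (snd w)(n := (fst (snd w n), d)))"

text \<open>The channel of slot \<open>m + 1\<close> is stored in entry \<open>m\<close> of the noise.\<close>

definition resample_channel where
  "resample_channel n w h =
     (case n of 0 \<Rightarrow> (h, snd w) | Suc m \<Rightarrow> (fst w, (snd w)(m := (h, snd (snd w m)))))"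

lemma resampling_arrivals: "resampling P arrivals (resample_arrivals n)"
  unfolding resample_arrivals_def[abs_def] noise_def
  by (intro resampling_pair_snd resampling_PiM resampling_snd prob_space_arrivals
      prob_space_slot_law prob_space_noise[unfolded noise_def])

lemma resampling_channel: "resampling P complex_normal (resample_channel n)"
proof (cases n)
  case 0
  then show ?thesis
    using resampling_fst[OF prob_space_complex_normal prob_space_noise]
    by (simp add: resample_channel_def[abs_def])
next
  case (Suc m)
  have "resampling P complex_normal (\<lambda>w h. (fst w, (snd w)(m := (h, snd (snd w m)))))"
    unfolding noise_def
    by (intro resampling_pair_snd resampling_PiM resampling_fst prob_space_arrivals
      prob_space_complex_normal prob_space_slot_law prob_space_noise[unfolded noise_def])
  with Suc show ?thesis by (simp add: resample_channel_def[abs_def])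
qed

lemma hist_resample_arrivals: "hist n (resample_arrivals n w d) = hist n w"
  by (simp add: hist_def resample_arrivals_def history_fun_upd)

text \<open>State and power of slot \<open>n\<close> stay fixed while the arrivals become
  \<open>d\<close>, so integrating over \<open>d\<close> yields exactly the integral in
  \<open>cost_to_go\<close>.\<close>

lemma hist_Suc_resample_arrivals:
  "X (Suc n) (resample_arrivals n w d) =
     (fst (snd w n), next_data S (X n w) (tx_power n w) (fst d), next_energy S (X n w) (tx_power n w) (snd d))"
  by (simp add: hist_Suc tx_power_def hist_resample_arrivals) (simp add: resample_arrivals_def)

text \<open>The queues of slot \<open>n\<close> are initial data or depend on states and powers of
  earlier slots, none of which sees the channel of slot \<open>n\<close>.\<close>

lemma X_resample_channel: "X n (resample_channel n w h) = (h, snd (X n w))"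
proof (cases n)
  case 0
  then show ?thesis by (simp add: X_0 resample_channel_def)
next
  case (Suc m)
  have "hist m (resample_channel n w h) = hist m w"
    using Suc by (simp add: hist_def resample_channel_def history_fun_upd)
  then show ?thesis using Suc by (simp add: hist_Suc tx_power_def) (simp add: resample_channel_def)
qed

lemma nonneg_arrivals_resample_channel:
  "nonneg_arrivals (snd w) \<Longrightarrow> nonneg_arrivals (snd (resample_channel n w h))"
  by (auto simp: nonneg_arrivals_def resample_channel_def split: nat.split)

section \<open>Averaging the cost of one slot\<close>

abbreviation "V_at V n w \<equiv> V (data_queue (X n w)) (energy_queue (X n w))"

text \<open>The cost-to-go is the delay cost plus the average of \<open>V\<close> at slot
  \<open>n + 1\<close> over redrawn arrivals, and redrawing does not change the expectation.\<close>

lemma integral_cost: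
  assumes V: "integrable P (V_at V (Suc n))"
  shows "integrable P (cost V n)"
    and "(\<integral>w. cost V n w \<partial>P) = (\<integral>w. data_queue (X n w) / mean_data S \<partial>P)
      + (\<integral>w. V_at V (Suc n) w \<partial>P)"
proof -
  note R = resampling_integral[OF resampling_arrivals prob_space_P prob_space_arrivals V, of n]
  have cost: "cost V n w = data_queue (X n w) / mean_data S + (\<integral>d. V_at V (Suc n) (resample_arrivals n w d) \<partial>arrivals)" for w
    by (simp add: cost_def cost_to_go_def hist_Suc_resample_arrivals case_prod_beta')
  show "integrable P (cost V n)"
    unfolding cost[abs_def] using R(2) integrable_data_queue by simp
  show "(\<integral>w. cost V n w \<partial>P) = (\<integral>w. data_queue (X n w) / mean_data S \<partial>P) + (\<integral>w. V_at V (Suc n) w \<partial>P)"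
    unfolding cost using R(2,3) integrable_data_queue by (subst Bochner_Integration.integral_add) auto
qed

text \<open>An infimum of reals is a lower bound only for sets bounded below; the attained minimum
  provides the bound.\<close>

lemma INF_cost_to_go_le:
  assumes "optimality_equation S \<theta> V" "x \<in> state_space S" "p \<in> feasible S x"
  shows "(INF p\<in>feasible S x. cost_to_go S V x p) \<le> cost_to_go S V x p"
proof (rule cINF_lower)
  obtain p' where "attains_min S V x p'" using assms by (auto simp: optimality_equation_def)
  then show "bdd_below (cost_to_go S V x ` feasible S x)"
    by (auto simp: attains_min_def)
qed fact

lemma INF_cost_to_go_eq:
  assumes "attains_min S V x p"
  shows "(INF p\<in>feasible S x. cost_to_go S V x p) = cost_to_go S V x p"
  using assms unfolding attains_min_def by (intro cInf_eq_minimum) auto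

lemma integrable_INF_cost_to_go:
  assumes "optimality_equation S \<theta> V" "0 \<le> q'" "e' \<in> {0..capacity S}"
  shows "integrable complex_normal (\<lambda>h. INF p\<in>feasible S (h, q', e'). cost_to_go S V (h, q', e') p)"
    and "(\<integral>h. (INF p\<in>feasible S (h, q', e'). cost_to_go S V (h, q', e') p) \<partial>complex_normal) = \<theta> + V q' e'"
  using assms by (auto simp: optimality_equation_def)

text \<open>Given everything but the channel of slot \<open>n\<close>, the queues of slot \<open>n\<close> are fixed and only
  measurability in the channel is needed: the infimum in the optimality equation need not be
  jointly measurable in channel and queues.\<close>

lemma AE_channel_average_cost:
  assumes opt: "optimality_equation S \<theta> V" and V: "integrable P (V_at V (Suc n))"
  shows "AE w in P. \<theta> + V_at V n w \<le> (\<integral>h. cost V n (resample_channel n w h) \<partial>complex_normal)"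
    and "(\<And>w. nonneg_arrivals (snd w) \<Longrightarrow> attains_min S V (X n w) (tx_power n w)) \<Longrightarrow>
      AE w in P. \<theta> + V_at V n w = (\<integral>h. cost V n (resample_channel n w h) \<partial>complex_normal)"
proof -
  let ?m = "\<lambda>w h. INF p\<in>feasible S (h, snd (X n w)). cost_to_go S V (h, snd (X n w)) p"
  have m: "integrable complex_normal (?m w)" "(\<integral>h. ?m w h \<partial>complex_normal) = \<theta> + V_at V n w"
    if "nonneg_arrivals (snd w)" for w
    using integrable_INF_cost_to_go[OF opt, of "data_queue (X n w)" "energy_queue (X n w)"]
      hist_in_state_space[OF that, of n n] by (auto simp: state_space_def mem_Times_iff)
  note good = nonneg_arrivals_resample_channel
  show "AE w in P. \<theta> + V_at V n w \<le> (\<integral>h. cost V n (resample_channel n w h) \<partial>complex_normal)"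
    using AE_nonneg_arrivals
      resampling_integral(1)[OF resampling_channel prob_space_P prob_space_complex_normal
        integral_cost(1)[where V = V and n = n, OF V], of n]
  proof eventually_elim
    case (elim w)
    \<comment> \<open>Redrawing the channel keeps the arrivals nonnegative, so the power chosen
      after the redraw is feasible in the state formed by \<open>h\<close> and the old
      queues.\<close>
    have "?m w h \<le> cost V n (resample_channel n w h)" for h
      using INF_cost_to_go_le[OF opt hist_in_state_space power_feasible(1)[OF hist_in_state_space],
          OF good good, OF elim(1) elim(1)]
      unfolding cost_def by (metis X_resample_channel)
    then have "(\<integral>h. ?m w h \<partial>complex_normal) \<le> (\<integral>h. cost V n (resample_channel n w h) \<partial>complex_normal)"
      by (intro integral_mono m elim)
    then show ?case by (simp add: m(2)[OF elim(1)])
  qed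
  assume attains: "\<And>w. nonneg_arrivals (snd w) \<Longrightarrow> attains_min S V (X n w) (tx_power n w)"
  show "AE w in P. \<theta> + V_at V n w = (\<integral>h. cost V n (resample_channel n w h) \<partial>complex_normal)"
    using AE_nonneg_arrivals
  proof eventually_elim
    case (elim w)
    have "?m w h = cost V n (resample_channel n w h)" for h
      using INF_cost_to_go_eq[OF attains[OF good[OF elim]]]
      unfolding cost_def by (metis X_resample_channel)
    then show ?case using m(2)[OF elim] by simp
  qed
qed

text \<open>Redrawing the channel shows that the expected cost equals the expectation of its channel
  average, which is compared with \<open>\<theta> + V\<close> almost everywhere. Redrawing the
  arrivals splits the same expectation into delay cost and next value.\<close>

lemma drift:
  assumes opt: "optimality_equation S \<theta> V" and V: "\<And>n. integrable P (V_at V n)"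
  shows "\<theta> + (\<integral>w. V_at V n w \<partial>P)
      \<le> (\<integral>w. data_queue (X n w) / mean_data S \<partial>P) + (\<integral>w. V_at V (Suc n) w \<partial>P)"
    and "(\<And>w. nonneg_arrivals (snd w) \<Longrightarrow> attains_min S V (X n w) (tx_power n w)) \<Longrightarrow>
      \<theta> + (\<integral>w. V_at V n w \<partial>P)
      = (\<integral>w. data_queue (X n w) / mean_data S \<partial>P) + (\<integral>w. V_at V (Suc n) w \<partial>P)"
proof -
  interpret prob_space P by (rule prob_space_P)
  note C = integral_cost[where V = V and n = n, OF V]
  note R = resampling_integral[OF resampling_channel prob_space_P prob_space_complex_normal C(1), of n]
  note avg = AE_channel_average_cost[OF opt V, of n]
  have lhs: "\<theta> + (\<integral>w. V_at V n w \<partial>P) = (\<integral>w. \<theta> + V_at V n w \<partial>P)"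
    using V by (simp add: prob_space)
  have rhs: "(\<integral>w. data_queue (X n w) / mean_data S \<partial>P) + (\<integral>w. V_at V (Suc n) w \<partial>P)
      = (\<integral>w. (\<integral>h. cost V n (resample_channel n w h) \<partial>complex_normal) \<partial>P)"
    by (simp only: R(3) C(2))
  have int: "integrable P (\<lambda>w. \<theta> + V_at V n w)" using V by simp
  show "\<theta> + (\<integral>w. V_at V n w \<partial>P)
      \<le> (\<integral>w. data_queue (X n w) / mean_data S \<partial>P) + (\<integral>w. V_at V (Suc n) w \<partial>P)"
    unfolding lhs rhs by (rule integral_mono_AE[OF int R(2) avg(1)])
  show "\<theta> + (\<integral>w. V_at V n w \<partial>P)
      = (\<integral>w. data_queue (X n w) / mean_data S \<partial>P) + (\<integral>w. V_at V (Suc n) w \<partial>P)"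
    if "\<And>w. nonneg_arrivals (snd w) \<Longrightarrow> attains_min S V (X n w) (tx_power n w)"
    unfolding lhs rhs using int R(2) avg(2)[OF that]
    by (intro integral_cong_AE) (auto intro: borel_measurable_integrable)
qed

section \<open>From one-slot drift to long-run average delay\<close>

lemma avg_delay_eq:
  "avg_delay S \<pi> q e =
    limsup (\<lambda>N. ereal ((1 / real N) * (\<Sum>n<N. \<integral>w. data_queue (X n w) / mean_data S \<partial>P)))"
proof -
  have "(\<lambda>\<xi>. data_queue (\<xi> n) / mean_data S) \<in> borel_measurable (Pi\<^sub>M UNIV (\<lambda>_. borel :: state measure))" for n :: nat
    using measurable_state_components(2)[OF measurable_component_singleton[of n UNIV "\<lambda>_. borel"]] by simp
  then show ?thesis
    unfolding avg_delay_def
    by (subst integral_law_from_queues(1)[where g = "\<lambda>x. data_queue x / mean_data S"]) auto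
qed

lemma transversality_P:
  assumes "transversality S V \<pi>"
  shows "integrable P (V_at V n)"
    and "(\<lambda>N. (1 / real N) * (\<integral>w. V_at V N w \<partial>P)) \<longlonglongrightarrow> 0"
proof -
  have int: "integrable (law_from_queues S \<pi> q e) (\<lambda>\<xi>. V (data_queue (\<xi> n)) (energy_queue (\<xi> n)))" for n :: nat
    using assms q_nonneg e_bounds by (auto simp: transversality_def)
  \<comment> \<open>\<open>V\<close> carries no measurability assumption of its own; integrability
    of its values along the path supplies what is required.\<close>
  then have meas: "(\<lambda>\<xi>. V (data_queue (\<xi> n)) (energy_queue (\<xi> n)))
      \<in> borel_measurable (Pi\<^sub>M UNIV (\<lambda>_. borel :: state measure))" for n :: nat
    using borel_measurable_integrable[OF int[of n]]
    by (simp add: law_from_queues_def path_law_def)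
  note L = integral_law_from_queues[where g = "\<lambda>x. V (data_queue x) (energy_queue x)", OF meas]
  show "integrable P (V_at V n)" using int L(2) by simp
  show "(\<lambda>N. (1 / real N) * (\<integral>w. V_at V N w \<partial>P)) \<longlonglongrightarrow> 0"
    using assms q_nonneg e_bounds unfolding transversality_def L(1)[symmetric] by blast
qed

text \<open>The sum collapses to \<open>N * \<theta>\<close> plus the first minus the last expected
  value. After division by \<open>N\<close>, the first vanishes as a constant over \<open>N\<close>
  and the last by transversality.\<close>

lemma average_telescope_tendsto:
  assumes "transversality S V \<pi>"
  shows "(\<lambda>N. (1 / real N) * (\<Sum>n<N. \<theta> + (\<integral>w. V_at V n w \<partial>P) - (\<integral>w. V_at V (Suc n) w \<partial>P))) \<longlonglongrightarrow> \<theta>"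
proof -
  let ?v = "\<lambda>n. \<integral>w. V_at V n w \<partial>P"
  have "(\<lambda>N. \<theta> + (1 / real N) * ?v 0 - (1 / real N) * ?v N) \<longlonglongrightarrow> \<theta> + 0 * ?v 0 - 0"
    by (intro tendsto_intros lim_1_over_n transversality_P(2) assms)
  moreover have "\<forall>\<^sub>F N in sequentially. \<theta> + (1 / real N) * ?v 0 - (1 / real N) * ?v N
      = (1 / real N) * (\<Sum>n<N. \<theta> + ?v n - ?v (Suc n))"
    \<comment> \<open>At \<open>N = 0\<close> division by zero makes the right side \<open>0\<close>
      while the left side is \<open>\<theta>\<close>, hence the restriction to positive
      \<open>N\<close>.\<close>
    using eventually_gt_at_top[of 0]
  proof eventually_elim
    case (elim N)
    have *: "(\<Sum>n<N. \<theta> + ?v n - ?v (Suc n)) = real N * \<theta> + (?v 0 - ?v N)"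
      using sum_lessThan_telescope'[of ?v N] by (simp add: sum.distrib add_diff_eq[symmetric])
    show ?case unfolding * using elim by (simp add: field_simps)
  qed
  ultimately show ?thesis by (simp add: tendsto_cong)
qed

text \<open>The telescoped averages converge, so their limit superior is \<open>\<theta>\<close>,
  and drift bounds each summand by the expected delay cost.\<close>

lemma avg_delay_ge:
  assumes opt: "optimality_equation S \<theta> V" and tr: "transversality S V \<pi>"
  shows "ereal \<theta> \<le> avg_delay S \<pi> q e"
proof -
  let ?t = "\<lambda>n. \<theta> + (\<integral>w. V_at V n w \<partial>P) - (\<integral>w. V_at V (Suc n) w \<partial>P)"
  have "ereal \<theta> = limsup (\<lambda>N. ereal ((1 / real N) * (\<Sum>n<N. ?t n)))"
    using average_telescope_tendsto[OF tr, of \<theta>] by (intro lim_imp_Limsup[symmetric]) auto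
  also have "\<dots> \<le> avg_delay S \<pi> q e"
    unfolding avg_delay_eq
  proof (intro Limsup_mono always_eventually allI ereal_less_eq(3)[THEN iffD2] mult_left_mono sum_mono)
    fix n
    show "?t n \<le> (\<integral>w. data_queue (X n w) / mean_data S \<partial>P)"
      using drift(1)[OF opt transversality_P(1)[OF tr], of n] by simp
  qed simp
  finally show ?thesis .
qed

text \<open>With minimizing powers drift is an equality in every slot, so the delay averages are the
  telescoped averages and converge to \<open>\<theta>\<close>.\<close>

lemma avg_delay_eq_optimal:
  assumes opt: "optimality_equation S \<theta> V" and tr: "transversality S V \<pi>"
    and \<pi>: "\<And>n \<xi>. \<pi> n \<xi> = f (\<xi> n)" and f: "\<And>x. x \<in> state_space S \<Longrightarrow> attains_min S V x (f x)"
  shows "avg_delay S \<pi> q e = ereal \<theta>"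
proof -
  have "attains_min S V (X n w) (tx_power n w)" if "nonneg_arrivals (snd w)" for n w
    using f[OF hist_in_state_space[OF that]] by (simp add: tx_power_def \<pi>)
  note drift(2)[OF opt transversality_P(1)[OF tr] this]
  then have "(\<integral>w. data_queue (X n w) / mean_data S \<partial>P)
      = \<theta> + (\<integral>w. V_at V n w \<partial>P) - (\<integral>w. V_at V (Suc n) w \<partial>P)" for n
    by simp
  then show ?thesis
    using average_telescope_tendsto[OF tr, of \<theta>] unfolding avg_delay_eq
    by (intro lim_imp_Limsup) auto
qed

end

text \<open>The lower bound covers all admissible policies. That \<open>\<theta>\<close> is a
  minimum is witnessed by an admissible stationary choice of minimizers, which attains it from all
  initial queues simultaneously and is therefore optimal.\<close>

theorem theorem1:
  fixes S :: eh_system and \<theta> :: real and V :: "real \<Rightarrow> real \<Rightarrow> real"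
  assumes "eh_model S"
    and "optimality_equation S \<theta> V"
    and "\<And>\<pi>. admissible S \<pi> \<Longrightarrow> transversality S V \<pi>"
  shows "(\<forall>q\<ge>0. \<forall>e\<in>{0..capacity S}. \<forall>\<pi>. admissible S \<pi> \<longrightarrow> ereal \<theta> \<le> avg_delay S \<pi> q e) \<and>
    ((\<exists>f. admissible S (stationary f) \<and> (\<forall>x\<in>state_space S. attains_min S V x (f x))) \<longrightarrow>
       (\<forall>q\<ge>0. \<forall>e\<in>{0..capacity S}.
          (\<exists>\<pi>. admissible S \<pi> \<and> avg_delay S \<pi> q e = ereal \<theta>) \<and>
          (\<forall>\<pi>. admissible S \<pi> \<longrightarrow> ereal \<theta> \<le> avg_delay S \<pi> q e))) \<and>
    (\<forall>f. admissible S (stationary f) \<and> (\<forall>x\<in>state_space S. attains_min S V x (f x)) \<longrightarrow>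
       optimal_policy S (stationary f))"
proof -
  have queues: "controlled_queues S \<pi> q e"
    if "admissible S \<pi>" "0 \<le> q" "e \<in> {0..capacity S}" for \<pi> q e
    using that assms(1) by (simp add: controlled_queues_def admissible_def)
  have lower: "ereal \<theta> \<le> avg_delay S \<pi> q e"
    if "admissible S \<pi>" "0 \<le> q" "e \<in> {0..capacity S}" for \<pi> q e
    by (rule controlled_queues.avg_delay_ge[OF queues[OF that] assms(2) assms(3)[OF that(1)]])
  have attained: "avg_delay S (stationary f) q e = ereal \<theta>"
    if "admissible S (stationary f)" "\<forall>x\<in>state_space S. attains_min S V x (f x)"
      "0 \<le> q" "e \<in> {0..capacity S}" for f q e
    using controlled_queues.avg_delay_eq_optimal[OF queues[OF that(1,3,4)] assms(2) assms(3)[OF that(1)], of f] that(2)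
    by (simp add: stationary_def)
  show ?thesis
    using lower attained unfolding optimal_policy_def by (smt (verit))
qed

end
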